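(* Let $G=(U,V,E)$ be a finite bipartite graph and $F\subseteq E$. Then $G$ has a 2-chain subgraph cover $(G_1,G_2)$ such that $G_1$ has no edges in $F$ if and only if the set $E_c$ of committed edges of $G$ has an $(A,C)$-free bipartition.
   Context: Let $\hat{E}=\{uv: u\in U,\ v\in V,\ uv\notin E\}$. A chain graph is a bipartite graph with no induced $2K_2$. A 2-chain subgraph cover of $G$ is a pair $(G_1,G_2)$ with $G_i=(U,V,E_i)$, $E_i\subseteq E$, each $G_i$ a chain graph, and $E_1\cup E_2=E$. Two edges $u_1v_1,u_2v_2\in E$ ($u_i\in U$, $v_i\in V$) are in conflict in $G$ if $u_1v_2\notin E$ and $u_2v_1\notin E$ (i.e. the four vertices induce a $2K_2$). An edge of $E$ is committed if it is in conflict with some other edge of $E$; $E_c$ denotes the set of committed edges. A bipartition of $E_c$ is a pair $(E_r,E_b)$ with $E_r\cap E_b=\emptyset$, $E_r\cup E_b=E_c$, and $F\cap E_c\subseteq E_b$. Such a bipartition is $(A,C)$-free if there are no $u_1,u_2\in U$, $v_1,v_2\in V$ forming any of the configurations: $(A_1)$: $u_1v_1,u_2v_2\in E_r$ and $u_1v_2,u_2v_1\in\hat{E}$; $(A_2)$: $u_1v_1,u_2v_2\in E_b$ and $u_1v_2,u_2v_1\in\hat{E}$; $(C)$: $u_1v_1,u_2v_2\in E_r$, $u_1v_2\in\hat{E}$ and $u_2v_1\in F$. *)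

theory Defs
  imports Main
begin

text \<open>A bipartite graph G = (U, V, E) is represented by finite vertex sets U, V
(of two separate types, hence disjoint) and an edge set E of pairs (u, v) with
u in U and v in V; the pair (u, v) stands for the edge uv.\<close>

definition bipartite_graph :: "'u set \<Rightarrow> 'v set \<Rightarrow> ('u \<times> 'v) set \<Rightarrow> bool" where
  "bipartite_graph U V E \<longleftrightarrow> finite U \<and> finite V \<and> E \<subseteq> U \<times> V"

definition non_edges :: "'u set \<Rightarrow> 'v set \<Rightarrow> ('u \<times> 'v) set \<Rightarrow> ('u \<times> 'v) set" where
  "non_edges U V E = {(u, v). u \<in> U \<and> v \<in> V \<and> (u, v) \<notin> E}"

definition chain_graph :: "'u set \<Rightarrow> 'v set \<Rightarrow> ('u \<times> 'v) set \<Rightarrow> bool" where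
  "chain_graph U V E \<longleftrightarrow> bipartite_graph U V E \<and>
     \<not> (\<exists>u1\<in>U. \<exists>u2\<in>U. \<exists>v1\<in>V. \<exists>v2\<in>V.
          (u1, v1) \<in> E \<and> (u2, v2) \<in> E \<and> (u1, v2) \<notin> E \<and> (u2, v1) \<notin> E)"

definition two_chain_cover ::
  "'u set \<Rightarrow> 'v set \<Rightarrow> ('u \<times> 'v) set \<Rightarrow> ('u \<times> 'v) set \<Rightarrow> ('u \<times> 'v) set \<Rightarrow> bool" where
  "two_chain_cover U V E E1 E2 \<longleftrightarrow>
     E1 \<subseteq> E \<and> E2 \<subseteq> E \<and> chain_graph U V E1 \<and> chain_graph U V E2 \<and> E1 \<union> E2 = E"

definition in_conflict :: "('u \<times> 'v) set \<Rightarrow> ('u \<times> 'v) \<Rightarrow> ('u \<times> 'v) \<Rightarrow> bool" where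
  "in_conflict E e1 e2 \<longleftrightarrow> e1 \<in> E \<and> e2 \<in> E \<and>
     (fst e1, snd e2) \<notin> E \<and> (fst e2, snd e1) \<notin> E"

definition committed_edges :: "('u \<times> 'v) set \<Rightarrow> ('u \<times> 'v) set" where
  "committed_edges E = {e \<in> E. \<exists>e' \<in> E. e' \<noteq> e \<and> in_conflict E e e'}"

definition bipartition_Ec ::
  "('u \<times> 'v) set \<Rightarrow> ('u \<times> 'v) set \<Rightarrow> ('u \<times> 'v) set \<Rightarrow> ('u \<times> 'v) set \<Rightarrow> bool" where
  "bipartition_Ec E F Er Eb \<longleftrightarrow>
     Er \<inter> Eb = {} \<and> Er \<union> Eb = committed_edges E \<and> F \<inter> committed_edges E \<subseteq> Eb"

definition AC_free ::
  "'u set \<Rightarrow> 'v set \<Rightarrow> ('u \<times> 'v) set \<Rightarrow> ('u \<times> 'v) set \<Rightarrow> ('u \<times> 'v) set \<Rightarrow> ('u \<times> 'v) set \<Rightarrow> bool" where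
  "AC_free U V E F Er Eb \<longleftrightarrow>
     \<not> (\<exists>u1\<in>U. \<exists>u2\<in>U. \<exists>v1\<in>V. \<exists>v2\<in>V.
          ((u1, v1) \<in> Er \<and> (u2, v2) \<in> Er \<and> (u1, v2) \<in> non_edges U V E \<and> (u2, v1) \<in> non_edges U V E)
        \<or> ((u1, v1) \<in> Eb \<and> (u2, v2) \<in> Eb \<and> (u1, v2) \<in> non_edges U V E \<and> (u2, v1) \<in> non_edges U V E)
        \<or> ((u1, v1) \<in> Er \<and> (u2, v2) \<in> Er \<and> (u1, v2) \<in> non_edges U V E \<and> (u2, v1) \<in> F))"

end

theory Submission
  imports Defs
begin

text \<open>Conflicting edges must get different colours, so a cover is a 2-colouring of the conflict graph
  in which neither colour class has a longer alternating cycle either, where red cycles may also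
  step over edges of \<open>F\<close>. A shortest monochromatic cycle over non-edges has length six; call it
  a hexagon. As in the triangle lemma for transitive orientations, a hexagon can be dragged through
  the conflict component of each of its edges.

  Start from an \<open>(A,C)\<close>-free bipartition. The red edges on no hexagon have no alternating cycle
  and thus induce an injective ranking of \<open>U\<close>. Recolour every conflict component that meets a
  hexagon so that its edge of least rank becomes red. A lexicographic argument shows that no hexagon
  survives. Condition \<open>(C)\<close> survives as well: for a committed edge of \<open>F\<close> a violation is itself
  a hexagon, and for an uncommitted one the two edges concerned were not both recoloured to red.
  Finally, \<open>(C)\<close> allows one to eliminate the edges of \<open>F\<close> from alternating red cycles.\<close>

section \<open>Alternating cycles and chain graphs\<close>

text \<open>Steps join edges of \<open>N\<close> rather than vertices, so a cycle of the relation is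
  an alternating cycle. Taking \<open>A\<close> to be \<open>E - F\<close> instead of
  \<open>E\<close> permits steps over \<open>F\<close>.\<close>

definition alt_step :: "('u \<times> 'v) set \<Rightarrow> ('u \<times> 'v) set \<Rightarrow> (('u \<times> 'v) \<times> ('u \<times> 'v)) set" where
  "alt_step A N = {(e, e'). e \<in> N \<and> e' \<in> N \<and> (fst e, snd e') \<notin> A}"

lemma alt_step_iff: "(e, e') \<in> alt_step A N \<longleftrightarrow> e \<in> N \<and> e' \<in> N \<and> (fst e, snd e') \<notin> A"
  by (simp add: alt_step_def)

text \<open>Each arrow is witnessed by an edge of \<open>N\<close> at its head, and consecutive
  witnesses form an alternating step, so a cycle of vertices lifts to a cycle of edges.\<close>

lemma acyclic_left_vertices:
  assumes "acyclic (alt_step A N)"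
  shows "acyclic {(u, u'). u \<in> U \<and> (\<exists>v. (u, v) \<notin> A \<and> (u', v) \<in> N)}" (is "acyclic ?r")
proof (rule acyclicI, intro allI notI)
  have path: "\<exists>e e'. e \<in> N \<and> e' \<in> N \<and> (u, snd e) \<notin> A \<and> (e, e') \<in> (alt_step A N)\<^sup>* \<and> fst e' = u'"
    if "(u, u') \<in> ?r\<^sup>+" for u u'
    using that
  proof (induction rule: trancl_induct)
    case (base u')
    then obtain v where "(u, v) \<notin> A" "(u', v) \<in> N" by blast
    then show ?case by (intro exI[of _ "(u', v)"]) simp
  next
    case (step u' u'')
    then obtain e e' where *: "e \<in> N" "e' \<in> N" "(u, snd e) \<notin> A" "(e, e') \<in> (alt_step A N)\<^sup>*" "fst e' = u'"
      by blast
    from step.hyps obtain v where "(u', v) \<notin> A" "(u'', v) \<in> N" by blast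
    with * have "(e', (u'', v)) \<in> alt_step A N" by (simp add: alt_step_iff)
    with * have "(e, (u'', v)) \<in> (alt_step A N)\<^sup>*" by simp
    with * \<open>(u'', v) \<in> N\<close> show ?case by (metis fst_conv)
  qed
  fix u assume "(u, u) \<in> ?r\<^sup>+"
  from path[OF this] obtain e e' where *: "e \<in> N" "e' \<in> N" "(u, snd e) \<notin> A"
      "(e, e') \<in> (alt_step A N)\<^sup>*" "fst e' = u" by blast
  then have "(e', e) \<in> alt_step A N" by (simp add: alt_step_iff)
  with * have "(e, e) \<in> (alt_step A N)\<^sup>+" by (simp add: rtrancl_into_trancl1)
  with assms show False unfolding acyclic_def by blast
qed

text \<open>Vertices are ranked by their number of proper predecessors, with ties broken by a
  numbering below \<open>n\<close>.\<close>

lemma acyclic_injective_rank: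
  assumes fin: "finite U" and ac: "acyclic r" and sub: "r \<subseteq> U \<times> U"
  shows "\<exists>h :: 'u \<Rightarrow> nat. inj_on h U \<and> (\<forall>a b. (a, b) \<in> r \<longrightarrow> h a < h b)"
proof -
  obtain n and g :: "'u \<Rightarrow> nat" where g: "g ` U = {i. i < n}" "inj_on g U"
    using finite_imp_inj_to_nat_seg[OF fin] by blast
  define f where "f u = card {w \<in> U. (w, u) \<in> r\<^sup>+}" for u
  have gn: "g u < n" if "u \<in> U" for u using g(1) that by blast
  have f_less: "f a < f b" if "(a, b) \<in> r" for a b
    unfolding f_def
  proof (rule psubset_card_mono)
    have "a \<in> {w \<in> U. (w, b) \<in> r\<^sup>+}" using that sub by auto
    moreover have "a \<notin> {w \<in> U. (w, a) \<in> r\<^sup>+}" using ac by (auto simp: acyclic_def)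
    moreover have "{w \<in> U. (w, a) \<in> r\<^sup>+} \<subseteq> {w \<in> U. (w, b) \<in> r\<^sup>+}"
      using that by (auto intro: trancl_into_trancl)
    ultimately show "{w \<in> U. (w, a) \<in> r\<^sup>+} \<subset> {w \<in> U. (w, b) \<in> r\<^sup>+}" by blast
  qed (use fin in simp)
  show ?thesis
  proof (intro exI[of _ "\<lambda>u. f u * n + g u"] conjI allI impI)
    show "inj_on (\<lambda>u. f u * n + g u) U"
    proof (rule inj_onI)
      fix a b assume *: "a \<in> U" "b \<in> U" "f a * n + g a = f b * n + g b"
      from *(3) have "(f a * n + g a) mod n = (f b * n + g b) mod n" by (rule arg_cong)
      with gn[OF *(1)] gn[OF *(2)] have "g a = g b" by simp
      with g(2) * show "a = b" by (auto dest: inj_onD)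
    qed
    fix a b assume ab: "(a, b) \<in> r"
    then have "g a < n" using gn sub by blast
    then have "f a * n + g a < Suc (f a) * n" by simp
    also have "\<dots> \<le> f b * n" using f_less[OF ab] by (intro mult_right_mono) simp_all
    finally show "f a * n + g a < f b * n + g b" by simp
  qed
qed

text \<open>Rank the left vertices and join each \<open>v\<close> to every \<open>u\<close> ranked
  no lower than some \<open>N\<close>-neighbour of \<open>v\<close>. Neighbourhoods are then up-sets
  of one linear ranking, hence nested; a pair outside \<open>A\<close> would have its ranks the
  wrong way round.\<close>

lemma chain_extension:
  assumes "finite U" "finite V" "A \<subseteq> U \<times> V" "N \<subseteq> A" "acyclic (alt_step A N)"
  obtains C where "N \<subseteq> C" "C \<subseteq> A" "chain_graph U V C"
proof -
  define r where "r = {(u, u'). u \<in> U \<and> (\<exists>v. (u, v) \<notin> A \<and> (u', v) \<in> N)}"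
  have "acyclic r" unfolding r_def using assms(5) by (rule acyclic_left_vertices)
  moreover have "r \<subseteq> U \<times> U" using assms(3,4) unfolding r_def by auto
  ultimately obtain h :: "'a \<Rightarrow> nat" where "\<forall>a b. (a, b) \<in> r \<longrightarrow> h a < h b"
    using acyclic_injective_rank[OF assms(1), of r] by blast
  then have h: "h a < h b" if "a \<in> U" "(a, v) \<notin> A" "(b, v) \<in> N" for a b v
    using that unfolding r_def by blast
  define C where "C = {(u, v). u \<in> U \<and> v \<in> V \<and> (\<exists>u'. (u', v) \<in> N \<and> h u' \<le> h u)}"
  have "N \<subseteq> C" using assms unfolding C_def by auto
  moreover have "C \<subseteq> A"
  proof
    fix e assume "e \<in> C"
    then obtain u v u' where e: "e = (u, v)" "u \<in> U" "(u', v) \<in> N" "h u' \<le> h u"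
      unfolding C_def by blast
    show "e \<in> A"
    proof (rule ccontr)
      assume "e \<notin> A"
      with e have "h u < h u'" by (intro h[of u v u']) auto
      with e show False by simp
    qed
  qed
  moreover have "chain_graph U V C"
    unfolding chain_graph_def bipartite_graph_def
  proof (intro conjI notI)
    assume "\<exists>u1\<in>U. \<exists>u2\<in>U. \<exists>v1\<in>V. \<exists>v2\<in>V.
      (u1, v1) \<in> C \<and> (u2, v2) \<in> C \<and> (u1, v2) \<notin> C \<and> (u2, v1) \<notin> C"
    then obtain u1 u2 v1 v2 where "u1 \<in> U" "u2 \<in> U" "(u1, v1) \<in> C" "(u2, v2) \<in> C"
      "(u1, v2) \<notin> C" "(u2, v1) \<notin> C" by blast
    moreover from this obtain w1 w2 where "(w1, v1) \<in> N" "h w1 \<le> h u1" "(w2, v2) \<in> N" "h w2 \<le> h u2"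
      unfolding C_def by blast
    ultimately have "\<not> h w2 \<le> h u1" "\<not> h w1 \<le> h u2"
      unfolding C_def by blast+
    with \<open>h w1 \<le> h u1\<close> \<open>h w2 \<le> h u2\<close> show False by linarith
  qed (use assms C_def in auto)
  ultimately show ?thesis by (rule that)
qed

section \<open>Conflicts and hexagons\<close>

lemma in_conflict_pair [simp]:
  "in_conflict E (a, b) (c, d) \<longleftrightarrow> (a, b) \<in> E \<and> (c, d) \<in> E \<and> (a, d) \<notin> E \<and> (c, b) \<notin> E"
  by (simp add: in_conflict_def)

lemma committed_iff: "e \<in> committed_edges E \<longleftrightarrow> (\<exists>e'. in_conflict E e e')"
proof
  assume "\<exists>e'. in_conflict E e e'"
  then obtain e' where e': "in_conflict E e e'" by blast
  then have "e' \<noteq> e" by (auto simp: in_conflict_def)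
  with e' show "e \<in> committed_edges E" unfolding committed_edges_def in_conflict_def by blast
qed (auto simp only: committed_edges_def)

lemma in_conflict_sym: "in_conflict E e e' \<longleftrightarrow> in_conflict E e' e"
  by (auto simp: in_conflict_def)

definition conflict_rel :: "('u \<times> 'v) set \<Rightarrow> (('u \<times> 'v) \<times> ('u \<times> 'v)) set" where
  "conflict_rel E = {(e, e'). in_conflict E e e'}"

lemma sym_conflict_rtrancl: "sym ((conflict_rel E)\<^sup>*)"
  by (intro sym_rtrancl symI) (simp add: conflict_rel_def in_conflict_sym)

definition hexagon :: "('u \<times> 'v) set \<Rightarrow> ('u \<times> 'v) set \<Rightarrow> 'u \<Rightarrow> 'v \<Rightarrow> 'u \<Rightarrow> 'v \<Rightarrow> 'u \<Rightarrow> 'v \<Rightarrow> bool" where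
  "hexagon E X u1 v1 u2 v2 u3 v3 \<longleftrightarrow>
     (u1, v1) \<in> X \<and> (u2, v2) \<in> X \<and> (u3, v3) \<in> X \<and>
     (u1, v2) \<notin> E \<and> (u2, v3) \<notin> E \<and> (u3, v1) \<notin> E"

lemma hexagon_rotate: "hexagon E X u1 v1 u2 v2 u3 v3 \<Longrightarrow> hexagon E X u2 v2 u3 v3 u1 v1"
  by (auto simp: hexagon_def)

definition hexagonal_edge :: "('u \<times> 'v) set \<Rightarrow> ('u \<times> 'v) set \<Rightarrow> ('u \<times> 'v) \<Rightarrow> bool" where
  "hexagonal_edge E X e \<longleftrightarrow> (\<exists>u2 v2 u3 v3. hexagon E X (fst e) (snd e) u2 v2 u3 v3)"

text \<open>Edges without conflicts may lie in \<open>X\<close>, in \<open>Y\<close>, or in neither.\<close>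

locale conflict_coloring =
  fixes E X Y :: "('u \<times> 'v) set"
  assumes subs: "X \<subseteq> E" "Y \<subseteq> E"
    and disj: "X \<inter> Y = {}"
    and alternate: "in_conflict E e e' \<Longrightarrow> e \<in> X \<and> e' \<in> Y \<or> e \<in> Y \<and> e' \<in> X"
begin

lemma swap: "conflict_coloring E Y X"
  using subs disj alternate by unfold_locales blast+

lemma in_X: "in_conflict E e e' \<Longrightarrow> e \<in> Y \<Longrightarrow> e' \<in> X"
  using alternate disj by blast

lemma in_Y: "in_conflict E e e' \<Longrightarrow> e \<in> X \<Longrightarrow> e' \<in> Y"
  using alternate disj by blast

lemma no_conflict:
  assumes "(a, b) \<in> X" "(c, d) \<in> X" "(a, d) \<notin> E"
  shows "(c, b) \<in> E"
  using assms subs disj alternate[of "(a, b)" "(c, d)"] by auto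

text \<open>The three diagonals are edges because two edges of \<open>X\<close> never conflict. Each
  diagonal conflicts with the opposite edge of the hexagon and so lies in \<open>Y\<close>; the
  non-edges stay the same.\<close>

lemma hexagon_swap:
  assumes "hexagon E X u1 v1 u2 v2 u3 v3"
  shows "hexagon E Y u2 v1 u1 v3 u3 v2"
proof -
  have h: "(u1, v1) \<in> X" "(u2, v2) \<in> X" "(u3, v3) \<in> X" "(u1, v2) \<notin> E" "(u2, v3) \<notin> E" "(u3, v1) \<notin> E"
    using assms by (auto simp: hexagon_def)
  have "(u2, v1) \<in> E" "(u3, v2) \<in> E" "(u1, v3) \<in> E"
    using h no_conflict by blast+
  then show ?thesis
    using h subs in_Y[of "(u3, v3)" "(u2, v1)"] in_Y[of "(u2, v2)" "(u1, v3)"]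
      in_Y[of "(u1, v1)" "(u3, v2)"]
    by (auto simp: hexagon_def)
qed

text \<open>The diagonal \<open>(u3, v2)\<close> lies in \<open>Y\<close>, and any edge in conflict
  with it can take the place of \<open>(u1, v1)\<close>.\<close>

lemma hexagon_replace:
  assumes "hexagon E X u1 v1 u2 v2 u3 v3" "in_conflict E (u3, v2) (a, b)"
  shows "hexagon E X a b u2 v2 u3 v3"
  using assms hexagon_swap[OF assms(1)] in_X[OF assms(2)] by (auto simp: hexagon_def)

text \<open>This is \<open>hexagon_replace\<close> in the swapped hexagon: the diagonal
  \<open>(u3, v2)\<close> moves to another conflict partner of \<open>(u1, v1)\<close>.\<close>

lemma hexagon_replace_partner:
  assumes "hexagon E X u1 v1 u2 v2 u3 v3" "in_conflict E (u1, v1) (c, d)"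
  shows "hexagon E X u1 v1 u2 d c v3"
proof -
  interpret s: conflict_coloring E Y X by (rule swap)
  have "hexagon E Y u3 v2 u2 v1 u1 v3"
    using hexagon_swap[OF assms(1)] by (auto simp: hexagon_def)
  then have "hexagon E Y c d u2 v1 u1 v3"
    using s.hexagon_replace assms(2) by blast
  from s.hexagon_swap[OF this] show ?thesis by (auto simp: hexagon_def)
qed

text \<open>Walking through the conflict component of \<open>(u1, v1)\<close> drags the hexagon along, with
  \<open>u2\<close> and \<open>v3\<close> staying fixed (compare the triangle lemma for transitive orientations).\<close>

lemma hexagon_walk:
  assumes "hexagon E X u1 v1 u2 v2 u3 v3" "((u1, v1), e) \<in> (conflict_rel E)\<^sup>*"
  shows "(\<exists>c d. hexagon E X (fst e) (snd e) u2 d c v3) \<or> (\<exists>c d. hexagon E X c d u2 (snd e) (fst e) v3)"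
  using assms(2)
proof (induction rule: rtrancl_induct)
  case base
  with assms(1) show ?case by auto
next
  case (step e e')
  then have c: "in_conflict E (fst e, snd e) (fst e', snd e')" by (simp add: conflict_rel_def)
  from step.IH show ?case
    using hexagon_replace_partner[OF _ c] hexagon_replace[OF _ c] by blast
qed

text \<open>Since \<open>v3\<close> stays fixed, \<open>(a, v3)\<close> is a diagonal in one outcome
  of the walk and an edge of the hexagon in the other.\<close>

lemma hexagon_walk_edge:
  assumes "hexagon E X u1 v1 u2 v2 u3 v3" "((u1, v1), (a, b)) \<in> (conflict_rel E)\<^sup>*"
  shows "(a, v3) \<in> E"
proof -
  consider c d where "hexagon E X a b u2 d c v3" | c d where "hexagon E X c d u2 b a v3"
    using hexagon_walk[OF assms] unfolding fst_conv snd_conv by blast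
  then show ?thesis
  proof cases
    case 1
    from hexagon_swap[OF this] subs show ?thesis by (auto simp: hexagon_def)
  next
    case 2
    with subs show ?thesis by (auto simp: hexagon_def)
  qed
qed

text \<open>Move the diagonal to \<open>e'\<close>, then swap. Hence lying on a hexagon is a
  property of the whole conflict component.\<close>

lemma hexagonal_edge_conflict:
  assumes "hexagonal_edge E X e" "in_conflict E e e'"
  shows "hexagonal_edge E Y e'"
proof -
  from assms(1) obtain u2 v2 u3 v3 where "hexagon E X (fst e) (snd e) u2 v2 u3 v3"
    by (auto simp: hexagonal_edge_def)
  moreover have "in_conflict E (fst e, snd e) (fst e', snd e')" using assms(2) by simp
  ultimately have "hexagon E X (fst e) (snd e) u2 (snd e') (fst e') v3"
    by (rule hexagon_replace_partner)
  from hexagon_rotate[OF hexagon_rotate[OF hexagon_swap[OF this]]]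
  show ?thesis unfolding hexagonal_edge_def by blast
qed

text \<open>The edge \<open>(u2, v1)\<close> conflicts with \<open>(uk, v3)\<close>, where \<open>ek\<close> is the last edge of the cycle:
  if \<open>(u2, v1) \<in> X\<close> it replaces \<open>e1\<close> and \<open>e2\<close>, otherwise \<open>(uk, v3) \<in> X\<close> closes a hexagon
  through \<open>e2\<close>.\<close>

lemma no_alternating_cycle:
  assumes "N \<subseteq> X" and nohex: "\<And>e. e \<in> N \<Longrightarrow> \<not> hexagonal_edge E X e"
    and "e1 \<in> X" "(fst e1, snd e2) \<notin> E" "e2 \<in> N" "(e2, ek) \<in> alt_step E N ^^ n" "(fst ek, snd e1) \<notin> E"
  shows False
  using assms(3-)
\<comment> \<open>\<open>e1\<close> ranges over all of \<open>X\<close>, since the diagonal that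
  replaces it below may lie outside \<open>N\<close>.\<close>
proof (induction n arbitrary: e1 e2 ek rule: less_induct)
  case (less n)
  obtain u1 v1 where e1: "e1 = (u1, v1)" by fastforce
  obtain u2 v2 where e2: "e2 = (u2, v2)" by fastforce
  obtain uk vk where ek: "ek = (uk, vk)" by fastforce
  have X: "(u1, v1) \<in> X" "(u2, v2) \<in> X" "(u1, v2) \<notin> E" "(uk, v1) \<notin> E"
    using less.prems \<open>N \<subseteq> X\<close> e1 e2 ek by auto
  show False
  proof (cases n)
    case 0
    with less.prems X show False using no_conflict e2 ek by auto
  next
    case (Suc m)
    from less.prems(4) obtain e3 where e23: "(e2, e3) \<in> alt_step E N" and path: "(e3, ek) \<in> alt_step E N ^^ m"
      unfolding Suc by (meson relpow_Suc_D2)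
    obtain u3 v3 where e3: "e3 = (u3, v3)" by fastforce
    have X3: "(u3, v3) \<in> X" "(u2, v3) \<notin> E" "e3 \<in> N"
      using e23 \<open>N \<subseteq> X\<close> e2 e3 by (auto simp: alt_step_iff)
    have nohex2: False if "hexagon E X u2 v2 a b u1 v1" for a b
      using nohex[OF less.prems(3)] that e2 by (auto simp: hexagonal_edge_def)
    show False
    proof (cases m)
      case 0
      with path have "ek = e3" by simp
      with X X3 nohex2[of u3 v3] e3 ek show False by (auto simp: hexagon_def)
    next
      case (Suc l)
      from path obtain e4 where e34: "(e3, e4) \<in> alt_step E N" and path': "(e4, ek) \<in> alt_step E N ^^ l"
        unfolding Suc by (meson relpow_Suc_D2)
      have g: "(u2, v1) \<in> E" using X no_conflict by blast
      show False
      proof (cases "(uk, v3) \<in> E")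
        \<comment> \<open>The non-edge \<open>(uk, v3)\<close> closes the shorter cycle from
          \<open>e3\<close> to \<open>ek\<close>.\<close>
        case False
        show False
          by (rule less.IH[of l e3 e4 ek])
            (use e34 path' False X3 \<open>n = Suc m\<close> \<open>m = Suc l\<close> ek e3 in \<open>auto simp: alt_step_iff\<close>)
      next
        case True
        with g X X3 have c: "in_conflict E (u2, v1) (uk, v3)" by simp
        show False
        proof (cases "(u2, v1) \<in> X")
          case True
          show False
            by (rule less.IH[of m "(u2, v1)" e3 ek])
              (use True path X X3 \<open>n = Suc m\<close> ek e3 in auto)
        next
          case False
          with c alternate have "(uk, v3) \<in> X" by blast
          with X X3 nohex2[of uk v3] show False by (auto simp: hexagon_def)
        qed
      qed
    qed
  qed
qed

lemma acyclic_alt_step: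
  assumes "N \<subseteq> X" "\<And>e. e \<in> N \<Longrightarrow> \<not> hexagonal_edge E X e"
  shows "acyclic (alt_step E N)"
proof (rule acyclicI, intro allI notI)
  fix e assume "(e, e) \<in> (alt_step E N)\<^sup>+"
  then obtain f where f: "(e, f) \<in> alt_step E N" "(f, e) \<in> (alt_step E N)\<^sup>*"
    by (meson tranclD)
  have "f \<noteq> e" using f(1) assms(1) subs by (auto simp: alt_step_iff)
  with f(2) obtain g where g: "(f, g) \<in> (alt_step E N)\<^sup>*" "(g, e) \<in> alt_step E N"
    by (meson rtranclE)
  obtain n where "(f, g) \<in> alt_step E N ^^ n" using g(1) rtrancl_imp_relpow by metis
  then show False
    using no_alternating_cycle[OF assms, of e f g n] f(1) g(2) assms(1) by (auto simp: alt_step_iff)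
qed

text \<open>By the walk, the \<open>h\<close>-least left vertex \<open>u1\<close> of a hexagon would again be the left
  vertex of a second hexagon, reached through the component of \<open>(u1, v3)\<close>, in which
  \<open>(u1, v1)\<close> has the other colour.\<close>

lemma least_edge_coloring_no_hexagon:
  fixes h :: "'u \<Rightarrow> nat"
  assumes inj: "inj_on h (fst ` E)"
    and lex: "\<And>u v. (u, v) \<in> Y \<Longrightarrow> (u, v) \<in> committed_edges E \<Longrightarrow>
       \<exists>u' v'. (u', v') \<in> X \<and> ((u, v), (u', v')) \<in> (conflict_rel E)\<^sup>* \<and> h u' \<le> h u"
  shows "\<not> hexagon E X u1 v1 u2 v2 u3 v3"
proof (induction "h u1" arbitrary: u1 v1 u2 v2 u3 v3 rule: less_induct)
  case less
  show ?case
  proof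
    assume hex: "hexagon E X u1 v1 u2 v2 u3 v3"
    from hexagon_swap[OF this] have Y: "(u1, v3) \<in> Y" by (simp add: hexagon_def)
    have c: "in_conflict E (u2, v2) (u1, v3)"
      using hex Y subs by (auto simp: hexagon_def)
    then have "(u1, v3) \<in> committed_edges E"
      unfolding committed_iff using in_conflict_sym by blast
    with lex Y obtain u' v' where u': "(u', v') \<in> X" "((u1, v3), (u', v')) \<in> (conflict_rel E)\<^sup>*" "h u' \<le> h u1"
      by blast
    have "((u2, v2), (u', v')) \<in> (conflict_rel E)\<^sup>*"
      using c by (intro converse_rtrancl_into_rtrancl[OF _ u'(2)]) (simp add: conflict_rel_def)
    from hexagon_walk[OF hexagon_rotate[OF hex] this]
    consider (X) c d where "hexagon E X u' v' u3 d c v1" | (Y) c d where "hexagon E X c d u3 v' u' v1"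
      unfolding fst_conv snd_conv by blast
    then show False
    proof cases
      case X
      then have "\<not> h u' < h u1" using less[of u'] by blast
      with u'(3) have "h u' = h u1" by simp
      moreover have "u' \<in> fst ` E" "u1 \<in> fst ` E"
        using image_eqI[of u' fst "(u', v')" E] image_eqI[of u1 fst "(u1, v3)" E] u'(1) Y subs by auto
      ultimately have "u' = u1" using inj by (metis inj_onD)
      with hexagon_swap[OF X] hex disj show False by (auto simp: hexagon_def)
    next
      case Y
      from hexagon_swap[OF this] u'(1) disj show False by (auto simp: hexagon_def)
    qed
  qed
qed

end

text \<open>Think of \<open>(x, v1)\<close> as an uncommitted edge of \<open>F\<close>: the conflict path of length three from
  \<open>(x, y)\<close> to \<open>(u1, v1)\<close> rules out violations of \<open>(C)\<close> by these two edges in every colouring.\<close>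

lemma (in conflict_coloring) odd_conflict_path:
  assumes hex: "hexagon E X u1 v1 u2 v2 u3 v3"
    and c: "in_conflict E (x, y) (a, b)"
    and u1y: "(u1, y) \<notin> E" and f: "(x, v1) \<in> E" "(x, v1) \<notin> committed_edges E"
    and u2y: "(u2, y) \<in> E"
  shows "\<exists>e. in_conflict E (a, b) e \<and> in_conflict E e (u1, v1)"
proof (intro exI conjI)
  \<comment> \<open>Both \<open>(u2, v2)\<close> and \<open>(u2, y)\<close> conflict with the
    diagonal \<open>(u1, v3)\<close>, so \<open>v2\<close> can be replaced by
    \<open>y\<close>.\<close>
  have "in_conflict E (u1, v3) (u2, y)"
    using hexagon_swap[OF hex] u1y u2y subs hex by (auto simp: hexagon_def)
  from hexagon_replace[OF hexagon_rotate[OF hex] this]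
  have "hexagon E X u1 v1 u2 y u3 v3" by (auto simp: hexagon_def)
  from hexagon_swap[OF this] this have u3: "(u3, y) \<in> E" "(u3, v1) \<notin> E" "(u1, v1) \<in> E"
    using subs by (auto simp: hexagon_def)
  have "(u3, b) \<notin> E"
  proof
    assume "(u3, b) \<in> E"
    with c u3 f(1) have "in_conflict E (x, v1) (u3, b)" by simp
    with f(2) show False unfolding committed_iff by blast
  qed
  with c u3 show "in_conflict E (a, b) (u3, y)" by simp
  from u3 u1y show "in_conflict E (u3, y) (u1, v1)" by simp
qed

text \<open>The mirror image of \<open>odd_conflict_path\<close>: the two sides of the graph are
  exchanged, and the hexagon now passes through \<open>(x, y)\<close>.\<close>

lemma (in conflict_coloring) odd_conflict_path':
  assumes hex: "hexagon E X x y x2 y2 x3 y3"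
    and c: "in_conflict E (u1, v1) (a, b)"
    and u1y: "(u1, y) \<notin> E" and f: "(x, v1) \<in> E" "(x, v1) \<notin> committed_edges E"
    and u1y3: "(u1, y3) \<in> E"
  shows "\<exists>e. in_conflict E (a, b) e \<and> in_conflict E e (x, y)"
proof (intro exI conjI)
  have "in_conflict E (x2, y) (u1, y3)"
    using hexagon_swap[OF hex] u1y u1y3 subs hex by (auto simp: hexagon_def)
  from hexagon_replace[OF hexagon_rotate[OF hexagon_rotate[OF hex]] this]
  have "hexagon E X x y x2 y2 u1 y3" by (auto simp: hexagon_def)
  from hexagon_swap[OF this] this have u1: "(u1, y2) \<in> E" "(x, y2) \<notin> E" "(x, y) \<in> E"
    using subs by (auto simp: hexagon_def)
  have "(a, y2) \<notin> E"
  proof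
    assume "(a, y2) \<in> E"
    with c u1 f(1) have "in_conflict E (x, v1) (a, y2)" by simp
    with f(2) show False unfolding committed_iff by blast
  qed
  with c u1 show "in_conflict E (a, b) (u1, y2)" by simp
  from u1 u1y show "in_conflict E (u1, y2) (x, y)" by simp
qed

section \<open>Colourings satisfying condition (C)\<close>

text \<open>The two (A) conditions are absorbed by \<open>alternate\<close>. Exactly the committed
  edges are coloured, so every coloured edge has a conflict partner.\<close>

locale AC_coloring = conflict_coloring E R B for E R B :: "('u \<times> 'v) set" +
  fixes F :: "('u \<times> 'v) set"
  assumes F_sub: "F \<subseteq> E"
    and all: "R \<union> B = committed_edges E"
    and F_B: "F \<inter> committed_edges E \<subseteq> B"
    and C_free: "(u1, v1) \<in> R \<Longrightarrow> (u2, v2) \<in> R \<Longrightarrow> (u1, v2) \<notin> E \<Longrightarrow> (u2, v1) \<in> F \<Longrightarrow> False"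
begin

lemma partner:
  assumes "e \<in> R \<union> B"
  obtains e' where "in_conflict E e e'"
  using assms unfolding all committed_iff by blast

lemma F_disj_R: "F \<inter> R = {}"
  using F_B all disj by blast

text \<open>As \<open>(u1, v2)\<close> conflicts with nothing, non-neighbours of its two ends are
  never adjacent. With conflict partners \<open>(a, b)\<close> and \<open>(c, d)\<close> of the two
  red edges, this makes \<open>(u2, v1)\<close> conflict with \<open>(a, d)\<close>; were
  \<open>(u2, v1)\<close> blue, then \<open>(c, v1)\<close>, \<open>(u2, v2)\<close> and
  \<open>(a, d)\<close> would form a red hexagon.\<close>

lemma uncommitted_F_shortcut:
  assumes nohex: "\<And>u1 v1 u2 v2 u3 v3. \<not> hexagon E R u1 v1 u2 v2 u3 v3"
    and R: "(u1, v1) \<in> R" "(u2, v2) \<in> R"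
    and f: "(u1, v2) \<in> F" "(u1, v2) \<notin> committed_edges E"
  shows "(u2, v1) \<in> R"
proof -
  obtain a b where ab: "in_conflict E (u1, v1) (a, b)"
    using R partner by (metis UnI1 surj_pair)
  obtain c d where cd: "in_conflict E (u2, v2) (c, d)"
    using R partner by (metis UnI1 surj_pair)
  have B: "(a, b) \<in> B" "(c, d) \<in> B" using in_Y[OF ab] in_Y[OF cd] R by auto
  have f_free: "(p, q) \<notin> E" if "(u1, q) \<notin> E" "(p, v2) \<notin> E" for p q
    using f F_sub that unfolding committed_iff by (metis in_conflict_pair subsetD)
  have u2v1: "(u2, v1) \<in> E" using R f(1) C_free by blast
  have cb: "(c, b) \<notin> E" using f_free ab cd by auto
  have u1d: "(u1, d) \<in> E" using f_free[of d c] cd by auto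
  have ad: "(a, d) \<in> E"
  proof (rule ccontr)
    assume "(a, d) \<notin> E"
    with ab u1d have "in_conflict E (a, b) (u1, d)" by simp
    with B have "(u1, d) \<in> R" using in_X by blast
    with R(2) cd f(1) C_free show False by auto
  qed
  have c1: "in_conflict E (u2, v1) (a, d)" using u2v1 ad ab cd by simp
  show ?thesis
  proof (rule ccontr)
    assume "(u2, v1) \<notin> R"
    with c1 have B': "(u2, v1) \<in> B" "(a, d) \<in> R" using alternate by blast+
    interpret s: conflict_coloring E B R by (rule swap)
    have "(c, v1) \<in> E" using s.no_conflict[OF B'(1) B(2)] cd by simp
    with ab cb have "in_conflict E (a, b) (c, v1)" by simp
    with B have "(c, v1) \<in> R" using in_X by blast
    with R B' ab cd have "hexagon E R c v1 u2 v2 a d" by (simp add: hexagon_def)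
    with nohex show False by blast
  qed
qed

text \<open>A step over a committed edge of \<open>F\<close> is a detour of two steps over non-edges, and two edges
  joined by a step over an uncommitted one merge into a single edge of \<open>R\<close>. So alternating
  cycles can be freed of \<open>F\<close>.\<close>

lemma acyclic_avoiding_F:
  assumes nohex: "\<And>u1 v1 u2 v2 u3 v3. \<not> hexagon E R u1 v1 u2 v2 u3 v3"
  shows "acyclic (alt_step (E - F) R)"
proof -
  define T where "T = (alt_step E R)\<^sup>+"
  have "acyclic (alt_step E R)"
    using nohex by (intro acyclic_alt_step) (auto simp: hexagonal_edge_def)
  then have ac: "(e, e) \<notin> T" for e unfolding T_def acyclic_def by blast
  have T_trans: "(e, f) \<in> T \<Longrightarrow> (f, g) \<in> T \<Longrightarrow> (e, g) \<in> T" for e f g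
    unfolding T_def by (rule trancl_trans)
  have alt_step_cases: "(e, e') \<in> T \<or> (fst e', snd e) \<in> R \<and> (fst e, snd e') \<in> F"
    if "(e, e') \<in> alt_step (E - F) R" for e e'
  proof -
    obtain u1 v1 where e: "e = (u1, v1)" by fastforce
    obtain u2 v2 where e': "e' = (u2, v2)" by fastforce
    have R: "(u1, v1) \<in> R" "(u2, v2) \<in> R" "(u1, v2) \<notin> E \<or> (u1, v2) \<in> F"
      using that e e' by (auto simp: alt_step_iff)
    consider "(u1, v2) \<notin> E" | "(u1, v2) \<in> F" "(u1, v2) \<notin> committed_edges E"
      | "(u1, v2) \<in> F" "(u1, v2) \<in> committed_edges E" using R(3) by blast
    then show ?thesis
    proof cases
      case 1
      then show ?thesis using R unfolding T_def e e' by (intro disjI1 r_into_trancl) (simp add: alt_step_iff)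
    next
      case 2
      then show ?thesis using uncommitted_F_shortcut[OF nohex R(1,2)] e e' by simp
    next
      case 3
      then obtain c b where cb: "in_conflict E (u1, v2) (c, b)" unfolding committed_iff by auto
      with 3 F_B in_X have "(c, b) \<in> R" by blast
      with cb R have "((u1, v1), (c, b)) \<in> alt_step E R" "((c, b), (u2, v2)) \<in> alt_step E R"
        by (simp_all add: alt_step_iff)
      then have "((u1, v1), (u2, v2)) \<in> T" unfolding T_def by (meson r_into_trancl trancl_into_trancl)
      then show ?thesis unfolding e e' by blast
    qed
  qed
  \<comment> \<open>A path in \<open>T\<close> depends only on the left vertex of its first edge and
    the right vertex of its last.\<close>
  have left: "(e, g) \<in> T" if "(f, g) \<in> T" "fst e = fst f" "e \<in> R" for e f g
  proof -
    from that(1) obtain z where z: "(f, z) \<in> alt_step E R" "(z, g) \<in> (alt_step E R)\<^sup>*"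
      unfolding T_def by (meson tranclD)
    with that have "(e, z) \<in> alt_step E R" by (simp add: alt_step_iff)
    with z show ?thesis unfolding T_def by (meson rtrancl_into_trancl2)
  qed
  have right: "(e, g) \<in> T" if "(e, f) \<in> T" "snd g = snd f" "g \<in> R" for e f g
  proof -
    from that(1) obtain z where z: "(e, z) \<in> (alt_step E R)\<^sup>*" "(z, f) \<in> alt_step E R"
      unfolding T_def by (meson tranclD2)
    with that have "(z, g) \<in> alt_step E R" by (simp add: alt_step_iff)
    with z show ?thesis unfolding T_def by (meson rtrancl_into_trancl1)
  qed
  \<comment> \<open>\<open>g0\<close> and \<open>g1\<close> keep the end vertices needed to extend
    or close the path; \<open>g0 = g1\<close> covers a path merged into a single edge.\<close>
  have path: "\<exists>g0 g1. g0 \<in> R \<and> g1 \<in> R \<and> snd g0 = snd e \<and> fst g1 = fst e' \<and> (g0 = g1 \<or> (g0, g1) \<in> T)"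
    if "(e, e') \<in> (alt_step (E - F) R)\<^sup>*" "e \<in> R" for e e'
    using that(1)
  proof (induction rule: rtrancl_induct)
    case base
    with that(2) show ?case by blast
  next
    case (step e' e'')
    then obtain g0 g1 where g: "g0 \<in> R" "g1 \<in> R" "snd g0 = snd e" "fst g1 = fst e'" "g0 = g1 \<or> (g0, g1) \<in> T"
      by blast
    with step.hyps have s: "(g1, e'') \<in> alt_step (E - F) R" and R: "e'' \<in> R"
      by (auto simp: alt_step_iff)
    let ?h = "(fst e'', snd g1)"
    from alt_step_cases[OF s]
    consider "(g1, e'') \<in> T" | "?h \<in> R" by blast
    then show ?case
    proof cases
      case 1
      with g R T_trans show ?thesis by blast
    next
      case 2
      show ?thesis
      proof (cases "g0 = g1")
        case True
        with 2 g show ?thesis by (intro exI[of _ ?h]) simp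
      next
        case False
        with g right[of g0 g1 ?h] 2 have "(g0, ?h) \<in> T" by simp
        with 2 g show ?thesis by (intro exI[of _ g0] exI[of _ ?h]) simp
      qed
    qed
  qed
  show ?thesis
  proof (rule acyclicI, intro allI notI)
    fix e assume "(e, e) \<in> (alt_step (E - F) R)\<^sup>+"
    then obtain e' where e': "(e, e') \<in> (alt_step (E - F) R)\<^sup>*" "(e', e) \<in> alt_step (E - F) R"
      by (meson tranclD2)
    then have "e \<in> R" by (simp add: alt_step_iff)
    from path[OF e'(1) this] obtain g0 g1 where g: "g0 \<in> R" "g1 \<in> R" "snd g0 = snd e" "fst g1 = fst e'"
      "g0 = g1 \<or> (g0, g1) \<in> T" by blast
    with e'(2) have "(g1, g0) \<in> alt_step (E - F) R" by (auto simp: alt_step_iff)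
    from alt_step_cases[OF this] g(5) consider "(g1, g0) \<in> T"
      | "g0 = g1" "g0 \<in> F" | "(fst g0, snd g1) \<in> R" "(g0, g1) \<in> T"
      by auto
    then show False
    proof cases
      case 1
      with g(5) ac T_trans show False by blast
    next
      case 2
      with g F_disj_R show False by blast
    next
      case 3
      let ?h = "(fst g0, snd g1)"
      have "(?h, g1) \<in> T" using left[OF 3(2), of ?h] 3 by simp
      then have "(?h, ?h) \<in> T" using right[of ?h g1 ?h] 3 by simp
      with ac show False by blast
    qed
  qed
qed

text \<open>By \<open>(C)\<close>, an edge of \<open>F\<close> in a blue hexagon would forbid two of the red edges of that hexagon.\<close>

lemma hexagonal_not_F:
  assumes "hexagonal_edge E B e"
  shows "e \<notin> F"
proof
  interpret s: conflict_coloring E B R by (rule swap)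
  assume "e \<in> F"
  from assms obtain u2 v2 u3 v3 where h: "hexagon E B (fst e) (snd e) u2 v2 u3 v3"
    by (auto simp: hexagonal_edge_def)
  with s.hexagon_swap[OF h] C_free[of u2 "snd e" "fst e" v3] \<open>e \<in> F\<close> show False
    by (auto simp: hexagon_def)
qed

text \<open>In a component without hexagons the red edge of each conflict gets the lower rank, so
  its colours already suit \<open>least_edge_coloring_no_hexagon\<close>. The converse of the vertex
  relation is ranked to put red edges low.\<close>

lemma exists_rank:
  assumes "finite U" "E \<subseteq> U \<times> V"
  obtains h :: "'u \<Rightarrow> nat" where "inj_on h (fst ` E)"
    "\<And>u v u' v'. in_conflict E (u, v) (u', v') \<Longrightarrow> (u', v') \<in> R \<Longrightarrow> \<not> hexagonal_edge E R (u', v') \<Longrightarrow> h u' < h u"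
proof -
  define N where "N = {e \<in> R. \<not> hexagonal_edge E R e}"
  define r where "r = {(u, u'). u \<in> U \<and> (\<exists>v. (u, v) \<notin> E \<and> (u', v) \<in> N)}"
  have "acyclic (alt_step E N)" by (rule acyclic_alt_step) (auto simp: N_def)
  then have "acyclic (r\<inverse>)" unfolding r_def acyclic_converse by (rule acyclic_left_vertices)
  moreover have "r\<inverse> \<subseteq> U \<times> U" unfolding r_def N_def using assms subs by blast
  ultimately obtain h :: "'u \<Rightarrow> nat" where h: "inj_on h U" "\<And>a b. (a, b) \<in> r\<inverse> \<Longrightarrow> h a < h b"
    using acyclic_injective_rank[OF assms(1), of "r\<inverse>"] by blast
  show ?thesis
  proof (rule that[of h])
    show "inj_on h (fst ` E)" using h(1) by (rule inj_on_subset) (use assms(2) in auto)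
    fix u v u' v'
    assume "in_conflict E (u, v) (u', v')" "(u', v') \<in> R" "\<not> hexagonal_edge E R (u', v')"
    with assms(2) have "(u', u) \<in> r\<inverse>" unfolding r_def N_def by auto
    then show "h u' < h u" by (rule h(2))
  qed
qed

end

section \<open>Recolouring the hexagons\<close>

context AC_coloring
begin

lemma recolor:
  assumes U: "finite U" "E \<subseteq> U \<times> V"
  obtains R' B' where "AC_coloring E R' B' F"
    "\<And>u1 v1 u2 v2 u3 v3. \<not> hexagon E R' u1 v1 u2 v2 u3 v3"
proof -
  obtain h :: "'u \<Rightarrow> nat" where inj: "inj_on h (fst ` E)"
    and h: "\<And>u v u' v'. in_conflict E (u, v) (u', v') \<Longrightarrow> (u', v') \<in> R \<Longrightarrow>
              \<not> hexagonal_edge E R (u', v') \<Longrightarrow> h u' < h u"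
    using exists_rank[OF U] by blast
  interpret s: conflict_coloring E B R by (rule swap)
  define rep where "rep e = arg_min (\<lambda>e'. h (fst e')) (\<lambda>e'. (e, e') \<in> (conflict_rel E)\<^sup>*)" for e
  define hex where "hex e \<longleftrightarrow> hexagonal_edge E R e \<or> hexagonal_edge E B e" for e
  \<comment> \<open>Both \<open>hex\<close> and \<open>rep\<close> depend only on the conflict
    component of \<open>e\<close>, so components are flipped as a whole.\<close>
  define flip where "flip e \<longleftrightarrow> hex e \<and> rep e \<in> B" for e
  define R' where "R' = {e \<in> committed_edges E. (e \<in> R) \<noteq> flip e}"
  define B' where "B' = {e \<in> committed_edges E. (e \<in> B) \<noteq> flip e}"
  have rep: "(e, rep e) \<in> (conflict_rel E)\<^sup>*" for e
    unfolding rep_def by (rule arg_min_natI) (rule rtrancl_refl)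
  have rep_le: "h (fst (rep e)) \<le> h (fst e)" for e
    unfolding rep_def by (rule arg_min_nat_le) (rule rtrancl_refl)
  have rep_eq: "rep e = rep e'" if "(e, e') \<in> (conflict_rel E)\<^sup>*" for e e'
  proof -
    from that have "(e', e) \<in> (conflict_rel E)\<^sup>*" using sym_conflict_rtrancl by (metis symD)
    with that have "(e, f) \<in> (conflict_rel E)\<^sup>* \<longleftrightarrow> (e', f) \<in> (conflict_rel E)\<^sup>*" for f
      by (meson rtrancl_trans)
    then show ?thesis by (simp add: rep_def)
  qed
  have hex_conflict: "hex e'" if "hex e" "in_conflict E e e'" for e e'
    using that hexagonal_edge_conflict s.hexagonal_edge_conflict unfolding hex_def by blast
  have hex_rtrancl: "hex e'" if "(e, e') \<in> (conflict_rel E)\<^sup>*" "hex e" for e e'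
    using that by (induction rule: rtrancl_induct) (auto simp: conflict_rel_def intro: hex_conflict)
  have hex_colored: "e \<in> R \<union> B" if "hex e" for e
    using that unfolding hex_def hexagonal_edge_def hexagon_def by auto
  have flip_conflict: "flip e = flip e'" if "in_conflict E e e'" for e e'
  proof -
    from that have "(e, e') \<in> (conflict_rel E)\<^sup>*" by (simp add: conflict_rel_def r_into_rtrancl)
    then have "rep e = rep e'" by (rule rep_eq)
    moreover have "hex e = hex e'" using hex_conflict that in_conflict_sym by blast
    ultimately show ?thesis by (simp add: flip_def)
  qed
  have col: "conflict_coloring E R' B'"
  proof
    show "R' \<subseteq> E" "B' \<subseteq> E" unfolding R'_def B'_def committed_edges_def by auto
    show "R' \<inter> B' = {}" unfolding R'_def B'_def using all disj by blast
    fix e e' assume c: "in_conflict E e e'"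
    then have "e \<in> committed_edges E" "e' \<in> committed_edges E"
      using in_conflict_sym unfolding committed_iff by blast+
    then show "e \<in> R' \<and> e' \<in> B' \<or> e \<in> B' \<and> e' \<in> R'"
      using alternate[OF c] flip_conflict[OF c] disj unfolding R'_def B'_def by blast
  qed
  interpret n: conflict_coloring E R' B' by (rule col)
  have nohex: "\<not> hexagon E R' u1 v1 u2 v2 u3 v3" for u1 v1 u2 v2 u3 v3
  proof (rule n.least_edge_coloring_no_hexagon[OF inj])
    fix u v assume uv: "(u, v) \<in> B'" "(u, v) \<in> committed_edges E"
    show "\<exists>u' v'. (u', v') \<in> R' \<and> ((u, v), (u', v')) \<in> (conflict_rel E)\<^sup>* \<and> h u' \<le> h u"
    proof (cases "hex (u, v)")
      case True
      obtain u' v' where r: "rep (u, v) = (u', v')" by fastforce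
      with rep[of "(u, v)"] have p: "((u, v), (u', v')) \<in> (conflict_rel E)\<^sup>*" by simp
      then have "hex (u', v')" using True hex_rtrancl by blast
      moreover have "rep (u', v') = (u', v')" using rep_eq[OF p] r by simp
      \<comment> \<open>The representative is its own representative, so it is flipped exactly if it
        was blue.\<close>
      ultimately have "(u', v') \<in> R'"
        using hex_colored[of "(u', v')"] disj all unfolding R'_def flip_def by auto
      moreover have "h u' \<le> h u" using rep_le[of "(u, v)"] r by simp
      ultimately show ?thesis using p by blast
    next
      case False
      then have B: "(u, v) \<in> B" using uv unfolding B'_def flip_def by blast
      then obtain u' v' where c: "in_conflict E (u, v) (u', v')"
        using partner[of "(u, v)"] by (metis UnI2 surj_pair)
      have R: "(u', v') \<in> R" using in_X c B by blast
      have nh: "\<not> hex (u', v')" using False hex_conflict c in_conflict_sym by blast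
      then have "h u' < h u" using h[OF c R] by (simp add: hex_def)
      moreover have "(u', v') \<in> R'" using R nh all unfolding R'_def flip_def by blast
      moreover have "((u, v), (u', v')) \<in> (conflict_rel E)\<^sup>*"
        using c by (simp add: conflict_rel_def r_into_rtrancl)
      ultimately show ?thesis by (metis less_imp_le)
    qed
  qed
  have F_B': "F \<inter> committed_edges E \<subseteq> B'"
  proof
    fix e assume e: "e \<in> F \<inter> committed_edges E"
    then have "e \<in> B" using F_B by blast
    moreover have "\<not> hex e"
      using \<open>e \<in> B\<close> e disj hexagonal_not_F[of e]
      by (auto simp: hex_def hexagonal_edge_def hexagon_def)
    ultimately show "e \<in> B'" using e by (simp add: B'_def flip_def)
  qed
  have C': False
    if n1: "(u1, v1) \<in> R'" and n2: "(x, y) \<in> R'" and u1y: "(u1, y) \<notin> E" and f: "(x, v1) \<in> F"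
    for u1 v1 x y
  proof (cases "(x, v1) \<in> committed_edges E")
    case True
    then obtain c d where cd: "in_conflict E (x, v1) (c, d)" unfolding committed_iff by auto
    with f True F_B' n.in_X have "(c, d) \<in> R'" by blast
    with n1 n2 u1y cd have "hexagon E R' u1 v1 x y c d" by (simp add: hexagon_def)
    with nohex show False by blast
  next
    case uncommitted: False
    have fE: "(x, v1) \<in> E" using f F_sub by blast
    have comm: "(u1, v1) \<in> committed_edges E" "(x, y) \<in> committed_edges E"
      using n1 n2 by (auto simp: R'_def)
    obtain a b where ab: "in_conflict E (x, y) (a, b)" using comm(2) unfolding committed_iff by auto
    obtain c d where cd: "in_conflict E (u1, v1) (c, d)" using comm(1) unfolding committed_iff by auto
    have hexB: "hexagonal_edge E B e" if "e \<in> R'" "e \<notin> R" for e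
      using that disj all unfolding R'_def flip_def hex_def hexagonal_edge_def hexagon_def by auto
    \<comment> \<open>Otherwise an odd conflict path would give \<open>(x, y)\<close> and
      \<open>(u1, v1)\<close> different new colours.\<close>
    have not_y: "(w, y) \<notin> E" if "hexagon E B u1 v1 w v2 u3 v3" for w v2 u3 v3
    proof
      assume "(w, y) \<in> E"
      from s.odd_conflict_path[OF that ab u1y fE uncommitted this]
      obtain e where e: "in_conflict E (a, b) e" "in_conflict E e (u1, v1)" by blast
      have "(a, b) \<in> B'" using n.in_Y ab n2 by blast
      then have "(u1, v1) \<in> B'" using n.in_X n.in_Y e by blast
      with n1 n.disj show False by blast
    qed
    have not_u1: "(u1, w) \<notin> E" if "hexagon E B x y x2 y2 x3 w" for w x2 y2 x3
    proof
      assume "(u1, w) \<in> E"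
      from s.odd_conflict_path'[OF that cd u1y fE uncommitted this]
      obtain e where e: "in_conflict E (c, d) e" "in_conflict E e (x, y)" by blast
      have "(c, d) \<in> B'" using n.in_Y cd n1 by blast
      then have "(x, y) \<in> B'" using n.in_X n.in_Y e by blast
      with n2 n.disj show False by blast
    qed
    show False
    proof (cases "(u1, v1) \<in> R")
      case R1: True
      show False
      proof (cases "(x, y) \<in> R")
        case True
        with R1 u1y f C_free show False by blast
      next
        case False
        from hexB[OF n2 this] obtain x2 y2 x3 y3 where hx: "hexagon E B x y x2 y2 x3 y3"
          by (auto simp: hexagonal_edge_def)
        \<comment> \<open>An edge that was recoloured to red is replaced by an old red diagonal of
          its blue hexagon, which yields a violation of (C) in the old colouring.\<close>
        from s.hexagon_swap[OF hx] have "(x, y3) \<in> R" by (simp add: hexagon_def)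
        with R1 not_u1[OF hx] f C_free show False by blast
      qed
    next
      case R1: False
      from hexB[OF n1 this] obtain u2 v2 u3 v3 where hu: "hexagon E B u1 v1 u2 v2 u3 v3"
        by (auto simp: hexagonal_edge_def)
      from s.hexagon_swap[OF hu] have u2v1: "(u2, v1) \<in> R" by (simp add: hexagon_def)
      show False
      proof (cases "(x, y) \<in> R")
        case True
        with u2v1 not_y[OF hu] f C_free show False by blast
      next
        case False
        from hexB[OF n2 this] obtain x2 y2 x3 y3 where hx: "hexagon E B x y x2 y2 x3 y3"
          by (auto simp: hexagonal_edge_def)
        from s.hexagon_swap[OF hx] have xy3: "(x, y3) \<in> R" by (simp add: hexagon_def)
        \<comment> \<open>With both edges recoloured, the odd path is applied to
          \<open>(x, y3)\<close> in place of \<open>(x, y)\<close>. It puts \<open>(u1, v1)\<close>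
          into the component of \<open>(x2, y2)\<close>, and the walk with \<open>y\<close> fixed
          makes \<open>(u1, y)\<close> an edge.\<close>
        have u2y3: "(u2, y3) \<in> E" using u2v1 xy3 f C_free by blast
        have c1: "in_conflict E (x2, y2) (x, y3)"
          using hx xy3 subs by (auto simp: hexagon_def)
        then have "in_conflict E (x, y3) (x2, y2)" by (simp only: in_conflict_sym)
        from s.odd_conflict_path[OF hu this not_u1[OF hx] fE uncommitted u2y3]
        obtain e where e: "in_conflict E (x2, y2) e" "in_conflict E e (u1, v1)" by blast
        then have "((x2, y2), e) \<in> conflict_rel E" "(e, (u1, v1)) \<in> conflict_rel E"
          by (simp_all add: conflict_rel_def)
        then have "((x2, y2), (u1, v1)) \<in> (conflict_rel E)\<^sup>*"
          by (rule converse_rtrancl_into_rtrancl[OF _ r_into_rtrancl])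
        from s.hexagon_walk_edge[OF hexagon_rotate[OF hx] this] u1y show False by blast
      qed
    qed
  qed
  have "AC_coloring E R' B' F"
  proof
    show "R' \<union> B' = committed_edges E" unfolding R'_def B'_def using all disj by blast
  qed (use F_sub F_B' C' in auto)
  with nohex show ?thesis using that by blast
qed

end

section \<open>From a cover to a bipartition and back\<close>

theorem theorem4:
  fixes U :: "'u set" and V :: "'v set" and E F :: "('u \<times> 'v) set"
  assumes "bipartite_graph U V E"
    and "F \<subseteq> E"
  shows "(\<exists>E1 E2. two_chain_cover U V E E1 E2 \<and> E1 \<inter> F = {}) \<longleftrightarrow>
         (\<exists>Er Eb. bipartition_Ec E F Er Eb \<and> AC_free U V E F Er Eb)"
proof
  have U: "finite U" "finite V" "E \<subseteq> U \<times> V"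
    using assms(1) by (auto simp: bipartite_graph_def)
  {
    assume "\<exists>E1 E2. two_chain_cover U V E E1 E2 \<and> E1 \<inter> F = {}"
    then obtain E1 E2 where sub: "E1 \<subseteq> E" "E2 \<subseteq> E" and chain: "chain_graph U V E1" "chain_graph U V E2"
      and cover: "E1 \<union> E2 = E" and F: "E1 \<inter> F = {}"
      by (auto simp: two_chain_cover_def)
    have ch: "(u1, v2) \<in> C \<or> (u2, v1) \<in> C"
      if "(u1, v1) \<in> C" "(u2, v2) \<in> C" "chain_graph U V C" for C u1 v1 u2 v2
      using that unfolding chain_graph_def bipartite_graph_def by blast
    define Er where "Er = committed_edges E \<inter> E1"
    define Eb where "Eb = committed_edges E - E1"
    have "Eb \<subseteq> E2"
      using cover unfolding Eb_def committed_edges_def by blast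
    have "bipartition_Ec E F Er Eb"
      using F by (auto simp: bipartition_Ec_def Er_def Eb_def)
    moreover have "AC_free U V E F Er Eb"
      unfolding AC_free_def
    proof (intro notI, elim bexE)
      fix u1 u2 v1 v2
      assume "((u1, v1) \<in> Er \<and> (u2, v2) \<in> Er \<and> (u1, v2) \<in> non_edges U V E \<and> (u2, v1) \<in> non_edges U V E)
        \<or> ((u1, v1) \<in> Eb \<and> (u2, v2) \<in> Eb \<and> (u1, v2) \<in> non_edges U V E \<and> (u2, v1) \<in> non_edges U V E)
        \<or> ((u1, v1) \<in> Er \<and> (u2, v2) \<in> Er \<and> (u1, v2) \<in> non_edges U V E \<and> (u2, v1) \<in> F)"
      then have "(u1, v1) \<in> E1 \<and> (u2, v2) \<in> E1 \<and> (u1, v2) \<notin> E1 \<and> (u2, v1) \<notin> E1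
        \<or> (u1, v1) \<in> E2 \<and> (u2, v2) \<in> E2 \<and> (u1, v2) \<notin> E2 \<and> (u2, v1) \<notin> E2"
        using sub F \<open>Eb \<subseteq> E2\<close> unfolding Er_def non_edges_def by blast
      with ch chain show False by blast
    qed
    ultimately show "\<exists>Er Eb. bipartition_Ec E F Er Eb \<and> AC_free U V E F Er Eb" by blast
  next
    assume "\<exists>Er Eb. bipartition_Ec E F Er Eb \<and> AC_free U V E F Er Eb"
    then obtain R0 B0 where bp: "R0 \<inter> B0 = {}" "R0 \<union> B0 = committed_edges E" "F \<inter> committed_edges E \<subseteq> B0"
      and free: "AC_free U V E F R0 B0"
      by (auto simp: bipartition_Ec_def)
    have RB: "R0 \<subseteq> E" "B0 \<subseteq> E" using bp(2) unfolding committed_edges_def by blast+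
    have A: "\<not> (e \<in> R0 \<and> e' \<in> R0)" "\<not> (e \<in> B0 \<and> e' \<in> B0)" if "in_conflict E e e'" for e e'
    proof -
      obtain u1 v1 u2 v2 where e: "e = (u1, v1)" "e' = (u2, v2)" by fastforce
      have V: "u1 \<in> U" "u2 \<in> U" "v1 \<in> V" "v2 \<in> V"
        "(u1, v2) \<in> non_edges U V E" "(u2, v1) \<in> non_edges U V E"
        using that U by (auto simp: e non_edges_def)
      with free show "\<not> (e \<in> R0 \<and> e' \<in> R0)" "\<not> (e \<in> B0 \<and> e' \<in> B0)"
        unfolding AC_free_def e by blast+
    qed
    interpret AC_coloring E R0 B0 F
    proof
      fix e e' assume c: "in_conflict E e e'"
      then have "e \<in> R0 \<union> B0" "e' \<in> R0 \<union> B0"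
        using in_conflict_sym unfolding bp(2) committed_iff by blast+
      with A[OF c] show "e \<in> R0 \<and> e' \<in> B0 \<or> e \<in> B0 \<and> e' \<in> R0" by blast
    next
      fix u1 v1 u2 v2
      assume *: "(u1, v1) \<in> R0" "(u2, v2) \<in> R0" "(u1, v2) \<notin> E" "(u2, v1) \<in> F"
      then have "u1 \<in> U" "u2 \<in> U" "v1 \<in> V" "v2 \<in> V" "(u1, v2) \<in> non_edges U V E"
        using RB U by (auto simp: non_edges_def)
      with * free show False unfolding AC_free_def by blast
    qed (use RB bp assms(2) in auto)
    obtain R B where "AC_coloring E R B F"
      and nohex: "\<And>u1 v1 u2 v2 u3 v3. \<not> hexagon E R u1 v1 u2 v2 u3 v3"
      using recolor[OF U(1,3)] by blast
    then interpret n: AC_coloring E R B F by simp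
    have "acyclic (alt_step (E - F) R)" using n.acyclic_avoiding_F[OF nohex] .
    moreover have "R \<subseteq> E - F" using n.subs n.F_disj_R by blast
    ultimately obtain E1 where E1: "R \<subseteq> E1" "E1 \<subseteq> E - F" "chain_graph U V E1"
      using chain_extension[OF U(1,2), of "E - F" R] U(3) by blast
    \<comment> \<open>Uncommitted edges join the blue class so that the two chain graphs cover
      \<open>E\<close>; a hexagon among these edges would still swap to a red one.\<close>
    let ?B = "B \<union> (E - committed_edges E)"
    interpret b: conflict_coloring E ?B R
      using n.subs n.disj n.all n.alternate by unfold_locales blast+
    have "acyclic (alt_step E ?B)"
      using b.hexagon_swap nohex by (intro b.acyclic_alt_step) (auto simp: hexagonal_edge_def)
    then obtain E2 where E2: "?B \<subseteq> E2" "E2 \<subseteq> E" "chain_graph U V E2"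
      using chain_extension[OF U, of ?B] b.subs by blast
    have "E1 \<union> E2 = E" using E1 E2 n.all by blast
    with E1 E2 have "two_chain_cover U V E E1 E2 \<and> E1 \<inter> F = {}"
      unfolding two_chain_cover_def by blast
    then show "\<exists>E1 E2. two_chain_cover U V E E1 E2 \<and> E1 \<inter> F = {}" by blast
  }
qed

end
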